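(* Let $S\subset(0,+\infty)$. Then $\mathcal{U}^{c<}_S$ has the ordering property: for every $\mathbf{X}\in\mathcal{U}_S$ there is $\mathbf{Y}\in\mathcal{U}_S$ such that for any convex linear orderings $<^{\mathbf{X}}$ of $\mathbf{X}$ and $<^{\mathbf{Y}}$ of $\mathbf{Y}$, the ordered space $(\mathbf{Y},<^{\mathbf{Y}})$ contains a subset which, with the induced metric and ordering, is isomorphic to $(\mathbf{X},<^{\mathbf{X}})$.
   Context: A metric space is ultrametric if $d(x,z)\le\max(d(x,y),d(y,z))$ for all $x,y,z$. For $S\subset(0,+\infty)$, $\mathcal{U}_S$ is the class of finite ultrametric spaces with all nonzero distances in $S$, and $\mathcal{U}^{c<}_S$ is the class of pairs $(\mathbf{X},<)$ with $\mathbf{X}\in\mathcal{U}_S$ and $<$ a convex linear ordering of $\mathbf{X}$. A linear ordering of an ultrametric space is convex if every metric ball is convex with respect to it. Two ordered metric spaces are isomorphic if there is an order-preserving isometry of one onto the other. *)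

theory Defs
  imports "HOL-Analysis.Analysis"
begin

definition ultrametric :: "'a metric \<Rightarrow> bool" where
  "ultrametric X \<longleftrightarrow>
     (\<forall>x\<in>mspace X. \<forall>y\<in>mspace X. \<forall>z\<in>mspace X.
        mdist X x z \<le> max (mdist X x y) (mdist X y z))"

definition finite_ultrametrics :: "real set \<Rightarrow> 'a metric set" where
  "finite_ultrametrics S =
     {X. finite (mspace X) \<and> ultrametric X \<and>
         (\<forall>x\<in>mspace X. \<forall>y\<in>mspace X. mdist X x y \<noteq> 0 \<longrightarrow> mdist X x y \<in> S)}"

definition order_convex_in :: "'a set \<Rightarrow> 'a rel \<Rightarrow> 'a set \<Rightarrow> bool" where
  "order_convex_in M r C \<longleftrightarrow>
     (\<forall>x\<in>C. \<forall>z\<in>C. \<forall>y\<in>M. (x, y) \<in> r \<and> (y, z) \<in> r \<longrightarrow> y \<in> C)"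

text \<open>
  Orderings are strict. The library predicate \<^const>\<open>strict_linear_order_on\<close> does not confine the
  relation to the given set, hence the explicit inclusion. Both open and closed balls are
  required to be convex; for finite spaces either requirement implies the other (see
  \<open>convex_linear_ordering_iff_open\<close> and \<open>convex_linear_ordering_iff_closed\<close> below).
\<close>

definition convex_linear_ordering :: "'a metric \<Rightarrow> 'a rel \<Rightarrow> bool" where
  "convex_linear_ordering X r \<longleftrightarrow>
     r \<subseteq> mspace X \<times> mspace X \<and> strict_linear_order_on (mspace X) r \<and>
     (\<forall>x\<in>mspace X. \<forall>e. order_convex_in (mspace X) r (mball_of X x e) \<and>
                       order_convex_in (mspace X) r (mcball_of X x e))"

definition ordered_isometric :: "'a metric \<Rightarrow> 'a rel \<Rightarrow> 'b metric \<Rightarrow> 'b rel \<Rightarrow> bool" where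
  "ordered_isometric X r Y s \<longleftrightarrow>
     (\<exists>f. bij_betw f (mspace X) (mspace Y) \<and>
          (\<forall>x\<in>mspace X. \<forall>y\<in>mspace X. mdist Y (f x) (f y) = mdist X x y) \<and>
          (\<forall>x\<in>mspace X. \<forall>y\<in>mspace X. (x, y) \<in> r \<longleftrightarrow> (f x, f y) \<in> s))"

lemma mcball_of_eq_mball_of:
  assumes "finite (mspace X)"
  shows "\<exists>e'. mcball_of X x e = mball_of X x e'"
proof -
  define D where "D = {t \<in> mdist X x ` mspace X. e < t}"
  have fin: "finite D" using assms by (simp add: D_def)
  define e' where "e' = Min (insert (e + 1) D)"
  have "t \<le> e \<longleftrightarrow> t < e'" if "t \<in> mdist X x ` mspace X" for t
  proof
    assume "t \<le> e"
    moreover have "e < e'" using fin by (simp add: e'_def D_def)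
    ultimately show "t < e'" by simp
  next
    assume lt: "t < e'"
    show "t \<le> e"
    proof (rule ccontr)
      assume "\<not> t \<le> e"
      then have "t \<in> D" using that by (simp add: D_def)
      then have "e' \<le> t" using fin by (simp add: e'_def)
      with lt show False by simp
    qed
  qed
  then have "mcball_of X x e = mball_of X x e'" by auto
  then show ?thesis ..
qed

lemma mball_of_eq_mcball_of:
  assumes "finite (mspace X)"
  shows "\<exists>e'. mball_of X x e = mcball_of X x e'"
proof -
  define D where "D = {t \<in> mdist X x ` mspace X. t < e}"
  have fin: "finite D" using assms by (simp add: D_def)
  define e' where "e' = Max (insert (e - 1) D)"
  have "t < e \<longleftrightarrow> t \<le> e'" if "t \<in> mdist X x ` mspace X" for t
  proof
    assume "t < e"
    then have "t \<in> D" using that by (simp add: D_def)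
    then show "t \<le> e'" using fin by (simp add: e'_def)
  next
    assume "t \<le> e'"
    moreover have "e' < e" using fin by (simp add: e'_def D_def)
    ultimately show "t < e" by simp
  qed
  then have "mball_of X x e = mcball_of X x e'" by auto
  then show ?thesis ..
qed

lemma convex_linear_ordering_iff_open:
  assumes "finite (mspace X)"
  shows "convex_linear_ordering X r \<longleftrightarrow>
     r \<subseteq> mspace X \<times> mspace X \<and> strict_linear_order_on (mspace X) r \<and>
     (\<forall>x\<in>mspace X. \<forall>e. order_convex_in (mspace X) r (mball_of X x e))"
  unfolding convex_linear_ordering_def by (metis mcball_of_eq_mball_of [OF assms])

lemma convex_linear_ordering_iff_closed:
  assumes "finite (mspace X)"
  shows "convex_linear_ordering X r \<longleftrightarrow>
     r \<subseteq> mspace X \<times> mspace X \<and> strict_linear_order_on (mspace X) r \<and>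
     (\<forall>x\<in>mspace X. \<forall>e. order_convex_in (mspace X) r (mcball_of X x e))"
  unfolding convex_linear_ordering_def by (metis mball_of_eq_mcball_of [OF assms])

end

theory Submission
  imports Defs
begin

text \<open>
  If the distances of an \<open>n\<close>-point space \<open>X\<close> are \<open>s\<^sub>1 < \<dots> < s\<^sub>k\<close>, take for \<open>Y\<close> the leaves of the
  \<open>n\<close>-ary tree of height \<open>k\<close>, two leaves being at distance \<open>s\<^sub>i\<close> when they branch at level \<open>i\<close>.
  A convex ordering of \<open>Y\<close> orders the \<open>n\<close> top-level subtrees as blocks, and a convex ordering of
  \<open>X\<close> orders the at most \<open>n\<close> classes of points at distance less than \<open>s\<^sub>k\<close> as blocks. One places
  the latter increasingly in the former and recurses inside each block.
\<close>

section \<open>Convex orderings of ultrametric spaces\<close>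

text \<open>
  For an ultrametric, convexity of an ordering says exactly that \<open>d x z = max (d x y) (d y z)\<close>
  whenever \<open>x < y < z\<close>; conversely this identity implies the ultrametric inequality.
\<close>

locale convex_ordered =
  fixes M :: "'a set" and d :: "'a \<Rightarrow> 'a \<Rightarrow> real" and r :: "'a rel"
  assumes zero: "x \<in> M \<Longrightarrow> d x x = 0"
    and pos: "x \<in> M \<Longrightarrow> y \<in> M \<Longrightarrow> x \<noteq> y \<Longrightarrow> 0 < d x y"
    and sym: "x \<in> M \<Longrightarrow> y \<in> M \<Longrightarrow> d x y = d y x"
    and irrefl: "x \<in> M \<Longrightarrow> (x, x) \<notin> r"
    and total: "x \<in> M \<Longrightarrow> y \<in> M \<Longrightarrow> x \<noteq> y \<Longrightarrow> (x, y) \<in> r \<or> (y, x) \<in> r"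
    and trans: "x \<in> M \<Longrightarrow> y \<in> M \<Longrightarrow> z \<in> M \<Longrightarrow> (x, y) \<in> r \<Longrightarrow> (y, z) \<in> r \<Longrightarrow> (x, z) \<in> r"
    and between: "x \<in> M \<Longrightarrow> y \<in> M \<Longrightarrow> z \<in> M \<Longrightarrow> (x, y) \<in> r \<Longrightarrow> (y, z) \<in> r \<Longrightarrow>
                    d x z = max (d x y) (d y z)"
begin

text \<open>All axioms are universal conditions on points, so they pass along an injection. This
  serves for subspaces and, with \<open>f\<close> the embedding of a block, for the ordering that
  the block inherits.\<close>

lemma pullback:
  assumes f: "inj_on f N" "f ` N \<subseteq> M"
    and e: "\<And>x y. x \<in> N \<Longrightarrow> y \<in> N \<Longrightarrow> e x y = d (f x) (f y)"
  shows "convex_ordered N e (inv_image r f)"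
proof -
  have fM: "f x \<in> M" if "x \<in> N" for x using f(2) that by auto
  have ne: "f x \<noteq> f y" if "x \<in> N" "y \<in> N" "x \<noteq> y" for x y
    using inj_onD [OF f(1)] that by auto
  show ?thesis
  proof
    show "(x, y) \<in> inv_image r f \<or> (y, x) \<in> inv_image r f" if "x \<in> N" "y \<in> N" "x \<noteq> y" for x y
      using total [of "f x" "f y"] ne fM that by simp
    show "(x, z) \<in> inv_image r f"
      if "x \<in> N" "y \<in> N" "z \<in> N" "(x, y) \<in> inv_image r f" "(y, z) \<in> inv_image r f" for x y z
      using trans [of "f x" "f y" "f z"] fM that by simp
  qed (simp_all add: e fM ne zero pos sym irrefl between)
qed

lemma subset: "A \<subseteq> M \<Longrightarrow> convex_ordered A d r"
  using pullback [of "\<lambda>x. x" A d] by (simp add: inv_image_def)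

lemma asym: "x \<in> M \<Longrightarrow> y \<in> M \<Longrightarrow> (x, y) \<in> r \<Longrightarrow> (y, x) \<notin> r"
  using irrefl trans by blast

lemma nonneg: "x \<in> M \<Longrightarrow> y \<in> M \<Longrightarrow> 0 \<le> d x y"
  using zero [of x] pos [of x y] by (cases "x = y") auto

text \<open>Among three distinct points \<open>between\<close> makes the distance of the outer two
  the larger of the other two distances, so the largest distance occurs twice.\<close>

lemma ultra:
  assumes "x \<in> M" "y \<in> M" "z \<in> M"
  shows "d x z \<le> max (d x y) (d y z)"
proof (cases "x = y \<or> y = z \<or> x = z")
  case True
  then show ?thesis using assms nonneg [of x y] zero [of x] by auto
next
  case False
  then consider "(x, y) \<in> r" "(y, z) \<in> r" | "(x, z) \<in> r" "(z, y) \<in> r" | "(y, x) \<in> r" "(x, z) \<in> r"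
    | "(z, y) \<in> r" "(y, x) \<in> r" | "(y, z) \<in> r" "(z, x) \<in> r" | "(z, x) \<in> r" "(x, y) \<in> r"
    using total assms by metis
  then show ?thesis
    by cases (use assms between sym in \<open>force+\<close>)
qed

text \<open>Were \<open>y\<close> before \<open>x'\<close>, then \<open>between\<close> for
  \<open>x\<close>, \<open>y\<close>, \<open>x'\<close> would give
  \<open>d x x' \<ge> d x y\<close>. With its mirror image \<open>less_move_right\<close>, this
  makes the order of two blocks independent of representatives.\<close>

lemma less_move_left:
  assumes "x \<in> M" "x' \<in> M" "y \<in> M" "(x, y) \<in> r" "d x x' < d x y"
  shows "(x', y) \<in> r"
proof -
  have "(y, x') \<notin> r" using between [of x y x'] assms by auto
  moreover have "x' \<noteq> y" using assms(5) by auto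
  ultimately show ?thesis using total assms(2,3) by blast
qed

lemma less_move_right:
  assumes "x \<in> M" "y \<in> M" "y' \<in> M" "(x, y) \<in> r" "d y y' < d x y"
  shows "(x, y') \<in> r"
proof -
  have "(y', x) \<notin> r" using between [of y' x y] sym [of y y'] assms by auto
  moreover have "x \<noteq> y'" using assms(5) sym [OF assms(1,2)] by auto
  ultimately show ?thesis using total assms(1,3) by blast
qed

end

section \<open>Enumeration of finite strict orders\<close>

text \<open>The number of predecessors is strictly monotone, hence injective on \<open>B\<close>,
  and stays below \<open>card B\<close>. So it maps \<open>B\<close> onto
  \<open>{..<card B}\<close>, and \<open>h\<close> is its inverse.\<close>

lemma strict_order_enumeration:
  fixes r :: "'a rel"
  assumes "finite B"
    and irrefl: "\<And>x. x \<in> B \<Longrightarrow> (x, x) \<notin> r"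
    and total: "\<And>x y. x \<in> B \<Longrightarrow> y \<in> B \<Longrightarrow> x \<noteq> y \<Longrightarrow> (x, y) \<in> r \<or> (y, x) \<in> r"
    and trans: "\<And>x y z. x \<in> B \<Longrightarrow> y \<in> B \<Longrightarrow> z \<in> B \<Longrightarrow> (x, y) \<in> r \<Longrightarrow> (y, z) \<in> r \<Longrightarrow> (x, z) \<in> r"
  obtains h where "\<And>k. k < card B \<Longrightarrow> h k \<in> B"
    and "\<And>k l. k < l \<Longrightarrow> l < card B \<Longrightarrow> (h k, h l) \<in> r"
proof -
  define rank where "rank x = card {y \<in> B. (y, x) \<in> r}" for x
  have mono: "rank x < rank y" if "x \<in> B" "y \<in> B" "(x, y) \<in> r" for x y
    unfolding rank_def
  proof (rule psubset_card_mono)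
    show "{z \<in> B. (z, x) \<in> r} \<subset> {z \<in> B. (z, y) \<in> r}"
      using that irrefl trans by blast
  qed (use \<open>finite B\<close> in simp)
  have inj: "inj_on rank B"
    by (rule inj_onI) (metis mono total less_irrefl)
  have "rank ` B \<subseteq> {..<card B}"
    unfolding rank_def using \<open>finite B\<close> irrefl by (auto intro!: psubset_card_mono)
  then have onto: "rank ` B = {..<card B}"
    by (simp add: card_image card_subset_eq inj)
  define h where "h = inv_into B rank"
  have hB: "h k \<in> B" and rank_h: "rank (h k) = k" if "k < card B" for k
    using that onto unfolding h_def by (auto simp: inv_into_into f_inv_into_f)
  show ?thesis
  proof
    show "(h k, h l) \<in> r" if "k < l" "l < card B" for k l
    proof -
      have kl: "h k \<in> B" "h l \<in> B" "rank (h k) < rank (h l)" using that hB rank_h by simp_all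
      then have "h k \<noteq> h l" "(h l, h k) \<notin> r" using mono [of "h l" "h k"] by auto
      then show ?thesis using total kl by blast
    qed
  qed (fact hB)
qed

section \<open>Ordered embeddings into a union of blocks\<close>

text \<open>Only pairs in \<open>s\<close> are constrained: between convex ordered spaces, totality,
  symmetry and asymmetry recover the rest. Carrier and distance are separate arguments so that
  \<open>A\<close> can be cut down to a subset.\<close>

definition ordered_embeds ::
    "'a set \<Rightarrow> ('a \<Rightarrow> 'a \<Rightarrow> real) \<Rightarrow> 'a rel \<Rightarrow> 'b set \<Rightarrow> ('b \<Rightarrow> 'b \<Rightarrow> real) \<Rightarrow> 'b rel \<Rightarrow> bool" where
  "ordered_embeds A dA s M d r \<longleftrightarrow>
     (\<exists>f. f ` A \<subseteq> M \<and>
          (\<forall>x\<in>A. \<forall>y\<in>A. (x, y) \<in> s \<longrightarrow> d (f x) (f y) = dA x y \<and> (f x, f y) \<in> r))"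

text \<open>The recursion over one level of the tree, with \<open>e i\<close> embedding the
  \<open>i\<close>-th copy of \<open>M\<close>. The hypothesis \<open>step\<close> ranges over all
  convex orderings \<open>q\<close> because \<open>r\<close> may order each copy
  differently.\<close>

lemma ordered_embeds_blocks:
  fixes e :: "nat \<Rightarrow> 'b \<Rightarrow> 'c"
  assumes N: "convex_ordered N dN r"
    and A: "convex_ordered A dA s" "finite A" "card A \<le> n"
    and "M \<noteq> {}" "0 < t"
    and eN: "\<And>i a. i < n \<Longrightarrow> a \<in> M \<Longrightarrow> e i a \<in> N"
    and inner: "\<And>i a b. i < n \<Longrightarrow> a \<in> M \<Longrightarrow> b \<in> M \<Longrightarrow> dN (e i a) (e i b) = dM a b"
    and outer: "\<And>i j a b. i < n \<Longrightarrow> j < n \<Longrightarrow> i \<noteq> j \<Longrightarrow> a \<in> M \<Longrightarrow> b \<in> M \<Longrightarrow>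
                  dN (e i a) (e j b) = t"
    and e_inj: "\<And>i. i < n \<Longrightarrow> inj_on (e i) M"
    and dM_less: "\<And>a b. a \<in> M \<Longrightarrow> b \<in> M \<Longrightarrow> dM a b < t"
    and dA_le: "\<And>x y. x \<in> A \<Longrightarrow> y \<in> A \<Longrightarrow> dA x y \<le> t"
    and step: "\<And>C q. C \<subseteq> A \<Longrightarrow> (\<And>x y. x \<in> C \<Longrightarrow> y \<in> C \<Longrightarrow> dA x y < t) \<Longrightarrow>
                 convex_ordered M dM q \<Longrightarrow> ordered_embeds C dA s M dM q"
  shows "ordered_embeds A dA s N dN r"
proof -
  interpret N: convex_ordered N dN r by (fact N)
  interpret A: convex_ordered A dA s by (fact A(1))
  obtain a0 where a0: "a0 \<in> M" using \<open>M \<noteq> {}\<close> by blast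
  define b where "b i = e i a0" for i
  have bN: "b i \<in> N" if "i < n" for i using eN a0 that by (simp add: b_def)
  have b_dist: "dN (b i) (b j) = t" if "i < n" "j < n" "i \<noteq> j" for i j
    using outer a0 that by (simp add: b_def)
  \<comment> \<open>\<open>h\<close> lists the block indices in the order that \<open>r\<close>
    gives to the representatives \<open>b i\<close>; these are distinct, being at pairwise distance
    \<open>t > 0\<close>.\<close>
  obtain h where h: "\<And>k. k < n \<Longrightarrow> h k < n"
    and h_less: "\<And>k l. k < l \<Longrightarrow> l < n \<Longrightarrow> (b (h k), b (h l)) \<in> r"
  proof (rule strict_order_enumeration [of "{..<n}" "inv_image r b"])
    show "(i, j) \<in> inv_image r b \<or> (j, i) \<in> inv_image r b"
      if "i \<in> {..<n}" "j \<in> {..<n}" "i \<noteq> j" for i j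
    proof -
      have "b i \<noteq> b j" using that b_dist [of i j] N.zero [of "b i"] bN [of i] \<open>0 < t\<close> by auto
      then show ?thesis using that bN N.total by simp
    qed
    show "(i, k) \<in> inv_image r b" if "i \<in> {..<n}" "j \<in> {..<n}" "k \<in> {..<n}"
      "(i, j) \<in> inv_image r b" "(j, k) \<in> inv_image r b" for i j k
      using that bN N.trans [of "b i" "b j" "b k"] by simp
  qed (use bN N.irrefl in auto)
  \<comment> \<open>Points of one block are less than \<open>t\<close> apart and different blocks
    are at distance \<open>t\<close>, so the representatives can be replaced one after the other,
    first the left, then the right.\<close>
  have block_less: "(e (h k) a, e (h l) c) \<in> r" if "k < l" "l < n" "a \<in> M" "c \<in> M" for k l a c
  proof -
    have hk: "h k < n" "h l < n" using h that by auto
    have "(b (h k), b (h l)) \<in> r" using h_less that by simp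
    moreover from this have ne: "h k \<noteq> h l" using N.irrefl bN hk by metis
    ultimately have "(e (h k) a, b (h l)) \<in> r"
      using N.less_move_left [of "b (h k)" "e (h k) a" "b (h l)"] b_dist [of "h k" "h l"]
        hk that bN eN inner a0 dM_less by (simp add: b_def)
    then show ?thesis
      using N.less_move_right [of "e (h k) a" "b (h l)" "e (h l) c"] outer [of "h k" "h l" a a0]
        hk ne that eN inner a0 dM_less by (simp add: b_def)
  qed

  (* card (before x), unlike the rank of the class of x, needs no choice of representatives; it is
     constant on classes, increasing across them, and less than card A. *)
  define cls where "cls x = {y \<in> A. dA x y < t}" for x
  define before where "before x = {y \<in> A. (y, x) \<in> s \<and> dA y x = t}" for x
  define pos where "pos x = card (before x)" for x
  have lt_trans: "dA x z < t" if "x \<in> A" "y \<in> A" "z \<in> A" "dA x y < t" "dA y z < t" for x y z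
    using A.ultra [of x y z] that by linarith
  have cls_eq: "cls x = cls y" if "x \<in> A" "y \<in> A" "dA x y < t" for x y
    unfolding cls_def using that lt_trans A.sym by (metis (lifting))
  have before_sub: "before x \<subseteq> before y" if xy: "x \<in> A" "y \<in> A" "dA x y < t" for x y
  proof
    fix z assume "z \<in> before x"
    then have z: "z \<in> A" "(z, x) \<in> s" "dA z x = t" by (auto simp: before_def)
    have "(z, y) \<in> s" using A.less_move_right [of z x y] z xy by simp
    \<comment> \<open>If \<open>dA z y\<close> were below \<open>t\<close>, then so would be
      \<open>dA z x\<close>, by way of \<open>y\<close>.\<close>
    moreover have "dA z y = t"
      using lt_trans [of z y x] dA_le [of z y] A.sym [of x y] z xy by force
    ultimately show "z \<in> before y" using z by (simp add: before_def)
  qed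
  have pos_eq: "pos x = pos y" if "x \<in> A" "y \<in> A" "dA x y < t" for x y
    unfolding pos_def using before_sub A.sym that by (metis subset_antisym)
  have fin: "finite (before x)" for x using A(2) by (simp add: before_def)
  have pos_less: "pos x < pos y" if xy: "x \<in> A" "y \<in> A" "(x, y) \<in> s" "dA x y = t" for x y
    unfolding pos_def
  proof (rule psubset_card_mono [OF fin])
    have "before x \<subseteq> before y"
    proof
      fix z assume "z \<in> before x"
      then have z: "z \<in> A" "(z, x) \<in> s" "dA z x = t" by (auto simp: before_def)
      then show "z \<in> before y"
        using A.trans [of z x y] A.between [of z x y] xy by (simp add: before_def)
    qed
    moreover have "x \<in> before y" "x \<notin> before x"
      using xy A.irrefl by (auto simp: before_def)
    ultimately show "before x \<subset> before y" by blast
  qed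
  have pos_n: "pos x < n" if "x \<in> A" for x
  proof -
    have "before x \<subset> A" using that A.irrefl by (auto simp: before_def)
    from psubset_card_mono [OF A(2) this] show ?thesis using A(3) by (simp add: pos_def)
  qed

  have "ordered_embeds (cls x) dA s M dM (inv_image r (e i))" if "x \<in> A" "i < n" for x i
  proof (rule step)
    show "dA y z < t" if "y \<in> cls x" "z \<in> cls x" for y z
      using that lt_trans [of y x z] A.sym \<open>x \<in> A\<close> by (auto simp: cls_def)
    show "convex_ordered M dM (inv_image r (e i))"
      by (rule N.pullback) (use that e_inj eN inner in auto)
  qed (auto simp: cls_def)
  \<comment> \<open>The map is indexed by the class, not by the point, so that all points of a class
    share it. The implication inside the existential lets the choice be made for every
    \<open>C\<close> and \<open>i\<close>.\<close>
  then have "\<exists>f. C \<in> cls ` A \<and> i < n \<longrightarrow> f ` C \<subseteq> M \<and> (\<forall>y\<in>C. \<forall>z\<in>C. (y, z) \<in> s \<longrightarrow>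
      dM (f y) (f z) = dA y z \<and> (f y, f z) \<in> inv_image r (e i))"
    for C i unfolding ordered_embeds_def by (cases "C \<in> cls ` A \<and> i < n") auto
  then obtain F where F: "\<And>C i. C \<in> cls ` A \<Longrightarrow> i < n \<Longrightarrow> F C i ` C \<subseteq> M \<and>
      (\<forall>y\<in>C. \<forall>z\<in>C. (y, z) \<in> s \<longrightarrow>
        dM (F C i y) (F C i z) = dA y z \<and> (F C i y, F C i z) \<in> inv_image r (e i))"
    by metis
  define i where "i x = h (pos x)" for x
  define g where "g x = F (cls x) (i x) x" for x
  have i_n: "i x < n" if "x \<in> A" for x
    using h pos_n that by (simp add: i_def)
  have self: "x \<in> cls x" if "x \<in> A" for x
    using that A.zero \<open>0 < t\<close> by (simp add: cls_def)
  have gM: "g x \<in> M" if "x \<in> A" for x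
    using F [of "cls x" "i x"] self i_n that unfolding g_def by blast
  have "dN (e (i x) (g x)) (e (i y) (g y)) = dA x y \<and> (e (i x) (g x), e (i y) (g y)) \<in> r"
    if xy: "x \<in> A" "y \<in> A" "(x, y) \<in> s" for x y
  proof (cases "dA x y < t")
    case True
    have eq: "cls y = cls x" "i y = i x"
      using cls_eq pos_eq xy True by (simp_all add: i_def)
    then have "y \<in> cls x" using self xy by metis
    then have "dM (g x) (g y) = dA x y \<and> (g x, g y) \<in> inv_image r (e (i x))"
      using F [of "cls x" "i x"] self i_n xy unfolding g_def eq by blast
    then show ?thesis
      using inner [of "i x" "g x" "g y"] i_n gM xy by (simp add: eq)
  next
    case False
    then have t: "dA x y = t" using dA_le xy by force
    then have less: "pos x < pos y" using pos_less xy by simp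
    then have r: "(e (i x) (g x), e (i y) (g y)) \<in> r"
      unfolding i_def using block_less gM pos_n xy by simp
    \<comment> \<open>The order of the representatives shows, by irreflexivity, that the two blocks
      differ; \<open>outer\<close> then gives distance \<open>t\<close>.\<close>
    have "(b (i x), b (i y)) \<in> r" using h_less less pos_n xy by (simp add: i_def)
    then have "i x \<noteq> i y" using N.irrefl bN i_n xy by metis
    then show ?thesis using r outer i_n gM xy t by simp
  qed
  moreover have "(\<lambda>x. e (i x) (g x)) ` A \<subseteq> N" using eN i_n gM by auto
  ultimately show ?thesis unfolding ordered_embeds_def by blast
qed

section \<open>The universal tree space\<close>

text \<open>Pairs of a block index and a point are coded as numbers so that the type stays
  \<open>nat metric\<close> at every height of the tree.\<close>

definition blocks_metric :: "nat \<Rightarrow> real \<Rightarrow> nat metric \<Rightarrow> nat metric" where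
  "blocks_metric n t Y = metric (prod_encode ` ({..<n} \<times> mspace Y),
     \<lambda>p q. let (i, a) = prod_decode p; (j, b) = prod_decode q in if i = j then mdist Y a b else t)"

text \<open>For the ultrametric inequality: if the end points lie in different blocks, the middle
  point misses one of these blocks and the maximum is \<open>t\<close>. If they share a block, a
  middle point outside gives \<open>t\<close>, which exceeds all distances of \<open>Y\<close>, and
  one inside reduces to \<open>Y\<close>.\<close>

lemma blocks_metric:
  assumes Y: "Y \<in> finite_ultrametrics D" and D: "\<And>s. s \<in> D \<Longrightarrow> s < t" and "0 < t"
  shows mspace_blocks_metric: "mspace (blocks_metric n t Y) = prod_encode ` ({..<n} \<times> mspace Y)"
    and mdist_blocks_metric: "mdist (blocks_metric n t Y) (prod_encode (i, a)) (prod_encode (j, b)) =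
          (if i = j then mdist Y a b else t)"
    and blocks_metric_ultrametric: "blocks_metric n t Y \<in> finite_ultrametrics (insert t D)"
proof -
  define M where "M = prod_encode ` ({..<n} \<times> mspace Y)"
  define d where "d = (\<lambda>p q. let (i, a) = prod_decode p; (j, b) = prod_decode q in
                         if i = j then mdist Y a b else t)"
  have d: "d (prod_encode (i, a)) (prod_encode (j, b)) = (if i = j then mdist Y a b else t)"
    for i a j b by (simp add: d_def)
  have fin: "finite (mspace Y)" and
    mem: "\<And>a b. a \<in> mspace Y \<Longrightarrow> b \<in> mspace Y \<Longrightarrow> mdist Y a b \<in> insert 0 D" and
    ult: "\<And>a b c. a \<in> mspace Y \<Longrightarrow> b \<in> mspace Y \<Longrightarrow> c \<in> mspace Y \<Longrightarrow>
            mdist Y a c \<le> max (mdist Y a b) (mdist Y b c)"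
    using Y by (auto simp: finite_ultrametrics_def ultrametric_def)
  have less: "mdist Y a b < t" if "a \<in> mspace Y" "b \<in> mspace Y" for a b
    using mem [OF that] D \<open>0 < t\<close> by auto
  \<comment> \<open>\<open>Metric_space\<close> asks for nonnegativity and symmetry at all
    arguments, not only on \<open>M\<close>.\<close>
  have nonneg: "0 \<le> d p q" for p q
    using \<open>0 < t\<close> by (simp add: d_def split: prod.split)
  have ultra: "d p q \<le> max (d p m) (d m q)" if M: "p \<in> M" "m \<in> M" "q \<in> M" for p q m
  proof -
    obtain i a j b k c where "p = prod_encode (i, a)" "m = prod_encode (j, b)"
      "q = prod_encode (k, c)" "a \<in> mspace Y" "b \<in> mspace Y" "c \<in> mspace Y"
      using M by (auto simp: M_def)
    then show ?thesis
      using ult [of a b c] less [of a c] by (auto simp: d)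
  qed
  interpret Metric_space M d
  proof
    show "d p q = d q p" for p q by (simp add: d_def mdist_commute split: prod.split)
    show "d p q = 0 \<longleftrightarrow> p = q" if "p \<in> M" "q \<in> M" for p q
      using that \<open>0 < t\<close> by (auto simp: M_def d split: if_splits)
    show "d p q \<le> d p m + d m q" if "p \<in> M" "m \<in> M" "q \<in> M" for p m q
      using ultra [OF that] nonneg [of p m] nonneg [of m q] by linarith
  qed (fact nonneg)
  have eq: "blocks_metric n t Y = metric (M, d)"
    by (simp add: blocks_metric_def M_def d_def)
  show "mspace (blocks_metric n t Y) = prod_encode ` ({..<n} \<times> mspace Y)"
    by (simp add: eq) (simp add: M_def)
  show "mdist (blocks_metric n t Y) (prod_encode (i, a)) (prod_encode (j, b)) =
          (if i = j then mdist Y a b else t)"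
    by (simp add: eq d)
  have "d p q \<in> insert 0 (insert t D)" if "p \<in> M" "q \<in> M" for p q
    using that mem unfolding M_def by (force simp: d)
  moreover have "finite M" using fin by (simp add: M_def)
  ultimately show "blocks_metric n t Y \<in> finite_ultrametrics (insert t D)"
    using ultra by (auto simp: finite_ultrametrics_def ultrametric_def eq)
qed

text \<open>Induction on \<open>D\<close> adds the largest distance last, as a new root level.
  \<open>Y\<close> is fixed before \<open>A\<close> and both orderings; its nonemptiness is carried
  along to supply the representatives of the blocks.\<close>

lemma universal_ultrametric:
  fixes D :: "real set"
  assumes "0 < n" "finite D" "D \<subseteq> {0<..}"
  shows "\<exists>Y :: nat metric. Y \<in> finite_ultrametrics D \<and> mspace Y \<noteq> {} \<and>
    (\<forall>(A :: 'a set) dA s r. finite A \<and> card A \<le> n \<and> convex_ordered A dA s \<and>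
       (\<forall>x\<in>A. \<forall>y\<in>A. dA x y \<in> insert 0 D) \<and> convex_ordered (mspace Y) (mdist Y) r \<longrightarrow>
       ordered_embeds A dA s (mspace Y) (mdist Y) r)"
  using assms(2,3)
proof (induction D rule: finite_linorder_max_induct)
  case empty
  let ?Y = "metric ({0 :: nat}, \<lambda>_ _. 0)"
  have singleton: "Metric_space {0 :: nat} (\<lambda>_ _. 0)" by (simp add: Metric_space_def)
  note Y = Metric_space.mspace_metric [OF singleton] Metric_space.mdist_metric [OF singleton]
  have "ordered_embeds A dA s (mspace ?Y) (mdist ?Y) r"
    if A: "convex_ordered A dA s" "\<forall>x\<in>A. \<forall>y\<in>A. dA x y \<in> insert 0 {}" for A :: "'a set" and dA s r
  proof -
    interpret A: convex_ordered A dA s by (fact A)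
    \<comment> \<open>All distances being 0, \<open>A\<close> has at most one point, so no pair
      needs checking.\<close>
    have "(x, y) \<notin> s" if "x \<in> A" "y \<in> A" for x y
      using A.pos [of x y] A.irrefl [of x] A(2) that by (cases "x = y") auto
    then show ?thesis by (auto simp: ordered_embeds_def Y)
  qed
  moreover have "?Y \<in> finite_ultrametrics {}"
    by (simp add: finite_ultrametrics_def ultrametric_def Y)
  ultimately show ?case using Y(1) by (intro exI [of _ ?Y]) simp
next
  case (insert t D)
  have D: "\<And>s. s \<in> D \<Longrightarrow> s < t" and "0 < t" and "D \<subseteq> {0<..}"
    using insert.hyps insert.prems by auto
  from insert.IH [OF this(3)] obtain Y :: "nat metric"
    where Y: "Y \<in> finite_ultrametrics D" "mspace Y \<noteq> {}"
      and IH: "\<And>(A :: 'a set) dA s r. finite A \<and> card A \<le> n \<and> convex_ordered A dA s \<and>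
        (\<forall>x\<in>A. \<forall>y\<in>A. dA x y \<in> insert 0 D) \<and> convex_ordered (mspace Y) (mdist Y) r \<Longrightarrow>
        ordered_embeds A dA s (mspace Y) (mdist Y) r"
    by blast
  let ?Y = "blocks_metric n t Y"
  note blocks = blocks_metric [OF Y(1) D \<open>0 < t\<close>]
  have "ordered_embeds A dA s (mspace ?Y) (mdist ?Y) r"
    if A: "finite A" "card A \<le> n" "convex_ordered A dA s"
      "\<forall>x\<in>A. \<forall>y\<in>A. dA x y \<in> insert 0 (insert t D)"
      and r: "convex_ordered (mspace ?Y) (mdist ?Y) r" for A :: "'a set" and dA s r
  proof (rule ordered_embeds_blocks [where e = "\<lambda>i a. prod_encode (i, a)" and dM = "mdist Y",
        OF r A(3,1,2) Y(2) \<open>0 < t\<close>])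
    show "mdist Y a b < t" if "a \<in> mspace Y" "b \<in> mspace Y" for a b
      using Y(1) D \<open>0 < t\<close> that unfolding finite_ultrametrics_def by fastforce
    show "dA x y \<le> t" if "x \<in> A" "y \<in> A" for x y
      using A(4) D \<open>0 < t\<close> that by fastforce
    show "ordered_embeds C dA s (mspace Y) (mdist Y) q"
      if C: "C \<subseteq> A" "\<And>x y. x \<in> C \<Longrightarrow> y \<in> C \<Longrightarrow> dA x y < t"
        and q: "convex_ordered (mspace Y) (mdist Y) q" for C q
    proof (intro IH conjI ballI)
      show "finite C" using A(1) C(1) by (rule rev_finite_subset)
      show "card C \<le> n" using card_mono [OF A(1) C(1)] A(2) by simp
      show "convex_ordered C dA s" using A(3) C(1) by (rule convex_ordered.subset)
      \<comment> \<open>Distances within \<open>C\<close> are below \<open>t\<close>, which removes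
        \<open>t\<close> from the possible values.\<close>
      show "dA x y \<in> insert 0 D" if "x \<in> C" "y \<in> C" for x y
        using A(4) C(1) C(2) [OF that] that by auto
    qed (fact q)
  qed (auto simp: blocks inj_on_def)
  moreover have "mspace ?Y \<noteq> {}" using blocks(1) Y(2) \<open>0 < n\<close> by auto
  ultimately show ?case using blocks(3) by blast
qed

section \<open>Convex linear orderings and the ordering property\<close>

text \<open>For \<open>x < y < z\<close>, the closed balls of radius \<open>mdist X x z\<close>
  about \<open>x\<close> and about \<open>z\<close> contain both end points, hence \<open>y\<close>.
  This bounds both shorter distances by \<open>mdist X x z\<close>; the ultrametric inequality is
  the other half.\<close>

lemma convex_linear_ordering_convex_ordered:
  assumes X: "ultrametric X" and r: "convex_linear_ordering X r"
  shows "convex_ordered (mspace X) (mdist X) r"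
proof -
  have lin: "strict_linear_order_on (mspace X) r"
    and conv: "\<And>x e. x \<in> mspace X \<Longrightarrow> order_convex_in (mspace X) r (mcball_of X x e)"
    using r by (auto simp: convex_linear_ordering_def)
  show ?thesis
  proof
    fix x y z assume xyz: "x \<in> mspace X" "y \<in> mspace X" "z \<in> mspace X" "(x, y) \<in> r" "(y, z) \<in> r"
    have "x \<in> mcball_of X c (mdist X x z) \<Longrightarrow> z \<in> mcball_of X c (mdist X x z) \<Longrightarrow>
        y \<in> mcball_of X c (mdist X x z)" if "c \<in> mspace X" for c
      using conv [OF that, of "mdist X x z"] xyz unfolding order_convex_in_def by blast
    note ball = this [of x] this [of z]
    have self: "mdist X c c = 0" if "c \<in> mspace X" for c using that by simp
    from ball
    have "y \<in> mcball_of X x (mdist X x z)" "y \<in> mcball_of X z (mdist X x z)"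
      using xyz self by (simp_all add: mdist_commute del: mdist_zero)
    moreover have "mdist X x z \<le> max (mdist X x y) (mdist X y z)"
      using X xyz by (simp add: ultrametric_def)
    ultimately show "mdist X x z = max (mdist X x y) (mdist X y z)"
      by (auto simp: mdist_commute)
  next
    show "0 < mdist X x y" if "x \<in> mspace X" "y \<in> mspace X" "x \<noteq> y" for x y
      using that mdist_nonneg [of X x y] by (simp add: less_le)
    show "(x, y) \<in> r \<or> (y, x) \<in> r" if "x \<in> mspace X" "y \<in> mspace X" "x \<noteq> y" for x y
      using lin that by (auto simp: strict_linear_order_on_def total_on_def)
  qed (use lin in \<open>auto simp: strict_linear_order_on_def irrefl_def mdist_commute dest: transD\<close>)
qed

text \<open>Distinct points are comparable in \<open>s\<close>, so symmetry extends the isometry to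
  all pairs, which gives injectivity. Order is reflected because \<open>r\<close> is asymmetric and
  irreflexive. \<open>Z\<close> is the image.\<close>

lemma ordered_embeds_ordered_isometric:
  assumes X: "convex_ordered (mspace X) (mdist X) s" and Y: "convex_ordered (mspace Y) (mdist Y) r"
    and embeds: "ordered_embeds (mspace X) (mdist X) s (mspace Y) (mdist Y) r"
  shows "\<exists>Z \<subseteq> mspace Y. ordered_isometric X s (submetric Y Z) (Restr r Z)"
proof -
  interpret X: convex_ordered "mspace X" "mdist X" s by (fact X)
  interpret Y: convex_ordered "mspace Y" "mdist Y" r by (fact Y)
  obtain f where f: "f ` mspace X \<subseteq> mspace Y"
    and emb: "\<And>x y. x \<in> mspace X \<Longrightarrow> y \<in> mspace X \<Longrightarrow> (x, y) \<in> s \<Longrightarrow>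
                mdist Y (f x) (f y) = mdist X x y \<and> (f x, f y) \<in> r"
    using embeds unfolding ordered_embeds_def by blast
  have fY: "f x \<in> mspace Y" if "x \<in> mspace X" for x using f that by blast
  have dist: "mdist Y (f x) (f y) = mdist X x y" if "x \<in> mspace X" "y \<in> mspace X" for x y
    using that X.total [of x y] emb [of x y] emb [of y x] fY
    by (cases "x = y") (auto simp: mdist_commute Y.zero X.zero)
  have ord: "(x, y) \<in> s \<longleftrightarrow> (f x, f y) \<in> r" if "x \<in> mspace X" "y \<in> mspace X" for x y
    using that X.total [of x y] emb [of x y] emb [of y x] fY Y.irrefl Y.asym X.irrefl by metis
  have "inj_on f (mspace X)"
    by (rule inj_onI) (metis dist fY mdist_zero)
  moreover have "mspace (submetric Y (f ` mspace X)) = f ` mspace X" using f by auto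
  ultimately have "ordered_isometric X s (submetric Y (f ` mspace X)) (Restr r (f ` mspace X))"
    unfolding ordered_isometric_def by (intro exI [of _ f]) (auto simp: bij_betw_def dist ord)
  then show ?thesis using f by blast
qed

theorem theorem3:
  fixes S :: "real set" and X :: "'a metric"
  assumes "S \<subseteq> {0<..}"
    and "X \<in> finite_ultrametrics S"
  shows "\<exists>Y :: nat metric. Y \<in> finite_ultrametrics S \<and>
    (\<forall>ltX ltY. convex_linear_ordering X ltX \<and> convex_linear_ordering Y ltY \<longrightarrow>
       (\<exists>Z \<subseteq> mspace Y. ordered_isometric X ltX (submetric Y Z) (Restr ltY Z)))"
proof -
  \<comment> \<open>\<open>S\<close> may be infinite, whereas the tree needs one level for each of
    finitely many distances.\<close>
  define D where "D = case_prod (mdist X) ` (mspace X \<times> mspace X) - {0}"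
  have fin: "finite (mspace X)" and "ultrametric X" and "D \<subseteq> S"
    using assms(2) unfolding finite_ultrametrics_def D_def by fastforce+
  have D: "mdist X x y \<in> insert 0 D" if "x \<in> mspace X" "y \<in> mspace X" for x y
    using that by (auto simp: D_def)
  have "finite D" "D \<subseteq> {0<..}" using fin assms(1) \<open>D \<subseteq> S\<close> by (auto simp: D_def)
  then obtain Y :: "nat metric" where Y: "Y \<in> finite_ultrametrics D"
    and embeds: "\<And>s r. convex_ordered (mspace X) (mdist X) s \<Longrightarrow>
      convex_ordered (mspace Y) (mdist Y) r \<Longrightarrow>
      ordered_embeds (mspace X) (mdist X) s (mspace Y) (mdist Y) r"
    \<comment> \<open>The successor keeps the branching number positive when \<open>X\<close> is
      empty.\<close>
    using universal_ultrametric [of "Suc (card (mspace X))" D, where 'a = 'a] fin D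
    by (metis le_SucI order_refl zero_less_Suc)
  have "ultrametric Y" "Y \<in> finite_ultrametrics S"
    using Y \<open>D \<subseteq> S\<close> by (auto simp: finite_ultrametrics_def)
  moreover have "\<exists>Z \<subseteq> mspace Y. ordered_isometric X ltX (submetric Y Z) (Restr ltY Z)"
    if "convex_linear_ordering X ltX" "convex_linear_ordering Y ltY" for ltX ltY
    using convex_linear_ordering_convex_ordered [OF \<open>ultrametric X\<close> that(1)]
      convex_linear_ordering_convex_ordered [OF \<open>ultrametric Y\<close> that(2)]
    by (intro ordered_embeds_ordered_isometric embeds)
  ultimately show ?thesis by blast
qed

end
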